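(* Let $G$ be a connected graph which is minimal with respect to chromatic index. Then $rd(G)\leq \Delta(G)$.
   Context: All graphs are simple, finite and undirected; $\Delta(G)$ is the maximum degree and $\chi'(G)$ the chromatic index. A graph $G$ with at least two edges is minimal with respect to chromatic index if $\chi'(G-e)=\chi'(G)-1$ for every edge $e$ of $G$. For an edge-coloring of $G$ (adjacent edges may receive the same color), an edge-cut $R$ is a rainbow cut if no two edges of $R$ have the same color; it is a $u$-$v$ rainbow cut if $u$ and $v$ lie in different components of $G-R$. $G$ is rainbow disconnected if every two vertices $u,v$ have a $u$-$v$ rainbow cut. For a nontrivial connected graph $G$, $rd(G)$ is the smallest number of colors in an edge-coloring making $G$ rainbow disconnected. *)

theory Defs
  imports "Graph_Theory.Graph_Theory"
begin

(* Simple finite undirected graphs are those of the locale pair_graph: finite, loop-free,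
   symmetric arc relations.  An undirected edge {u, v} corresponds to the two arcs (u, v)
   and (v, u); colourings and cuts are formulated on undirected edges. *)

definition edges :: "'a pair_pre_digraph \<Rightarrow> 'a set set" where
  "edges G = {{u, v} | u v. (u, v) \<in> parcs G}"

definition delete_edges :: "'a pair_pre_digraph \<Rightarrow> 'a set set \<Rightarrow> 'a pair_pre_digraph" where
  "delete_edges G R = G\<lparr>parcs := {(u, v) \<in> parcs G. {u, v} \<notin> R}\<rparr>"

(* By symmetry, the out-degree of a vertex is the number of edges incident with it. *)
definition max_degree :: "'a pair_pre_digraph \<Rightarrow> nat" where
  "max_degree G = Max (out_degree (with_proj G) ` pverts G)"

definition edge_coloring :: "'a pair_pre_digraph \<Rightarrow> nat \<Rightarrow> ('a set \<Rightarrow> nat) \<Rightarrow> bool" where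
  "edge_coloring G k c \<longleftrightarrow> c ` edges G \<subseteq> {1..k}"

definition proper_edge_coloring :: "'a pair_pre_digraph \<Rightarrow> nat \<Rightarrow> ('a set \<Rightarrow> nat) \<Rightarrow> bool" where
  "proper_edge_coloring G k c \<longleftrightarrow> edge_coloring G k c \<and>
     (\<forall>e \<in> edges G. \<forall>f \<in> edges G. e \<noteq> f \<and> e \<inter> f \<noteq> {} \<longrightarrow> c e \<noteq> c f)"

definition chromatic_index :: "'a pair_pre_digraph \<Rightarrow> nat" where
  "chromatic_index G = (LEAST k. \<exists>c. proper_edge_coloring G k c)"

definition minimal_chromatic_index :: "'a pair_pre_digraph \<Rightarrow> bool" where
  "minimal_chromatic_index G \<longleftrightarrow> 2 \<le> card (edges G) \<and>
     (\<forall>e \<in> edges G. int (chromatic_index (delete_edges G {e})) = int (chromatic_index G) - 1)"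

definition edge_cut :: "'a pair_pre_digraph \<Rightarrow> 'a set set \<Rightarrow> bool" where
  "edge_cut G R \<longleftrightarrow> R \<subseteq> edges G \<and> \<not> connected (with_proj (delete_edges G R))"

definition rainbow_cut :: "'a pair_pre_digraph \<Rightarrow> ('a set \<Rightarrow> nat) \<Rightarrow> 'a set set \<Rightarrow> bool" where
  "rainbow_cut G c R \<longleftrightarrow> edge_cut G R \<and> inj_on c R"

(* In a symmetric digraph, the strongly connected component scc_of u is the component of u. *)
definition uv_rainbow_cut ::
    "'a pair_pre_digraph \<Rightarrow> ('a set \<Rightarrow> nat) \<Rightarrow> 'a \<Rightarrow> 'a \<Rightarrow> 'a set set \<Rightarrow> bool" where
  "uv_rainbow_cut G c u v R \<longleftrightarrow> rainbow_cut G c R \<and>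
     pre_digraph.scc_of (with_proj (delete_edges G R)) u \<noteq>
     pre_digraph.scc_of (with_proj (delete_edges G R)) v"

definition rainbow_disconnected :: "'a pair_pre_digraph \<Rightarrow> ('a set \<Rightarrow> nat) \<Rightarrow> bool" where
  "rainbow_disconnected G c \<longleftrightarrow>
     (\<forall>u \<in> pverts G. \<forall>v \<in> pverts G. u \<noteq> v \<longrightarrow> (\<exists>R. uv_rainbow_cut G c u v R))"

definition rd :: "'a pair_pre_digraph \<Rightarrow> nat" where
  "rd G = (LEAST k. \<exists>c. edge_coloring G k c \<and> rainbow_disconnected G c)"

end

(* A vertex whose incident edges have distinct colours is separated from every other vertex by
   the cut formed by these edges, so it suffices to find a colouring with Delta colours for which
   this fails at one vertex at most.  A proper colouring will do if the chromatic index is at most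
   Delta.  Otherwise, by minimality, G - xy has a proper colouring with one colour less; the
   recolouring step of Vizing's theorem shows that this must be a colouring with exactly Delta
   colours.  Some colour is missing at x, because x has degree less than Delta in G - xy; giving
   it to xy spoils the colouring at y only. *)

theory Submission
  imports Defs "HOL-Combinatorics.Transposition"
begin

section \<open>Kempe chains\<close>

text \<open>Stated for a bare edge set, so that it applies to \<open>E - {e}\<close>, where the
  value of the colouring at the uncoloured edge \<open>e\<close> is ignored. The palette is tracked
  separately, as a bound on the image.\<close>

definition proper :: "'a set set \<Rightarrow> ('a set \<Rightarrow> 'c) \<Rightarrow> bool" where
  "proper E c \<longleftrightarrow> (\<forall>e\<in>E. \<forall>f\<in>E. e \<noteq> f \<and> e \<inter> f \<noteq> {} \<longrightarrow> c e \<noteq> c f)"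

definition misses :: "'a set set \<Rightarrow> ('a set \<Rightarrow> 'c) \<Rightarrow> 'a \<Rightarrow> 'c \<Rightarrow> bool" where
  "misses E c v \<gamma> \<longleftrightarrow> (\<forall>e\<in>E. v \<in> e \<longrightarrow> c e \<noteq> \<gamma>)"

text \<open>Such an \<open>S\<close> is a union of components of the graph formed by the edges of
  colours \<alpha> and \<beta>. Closure under complement then comes for free, which allows swapping
  everywhere off a chain.\<close>

definition kempe_closed :: "'a set set \<Rightarrow> ('a set \<Rightarrow> 'c) \<Rightarrow> 'c \<Rightarrow> 'c \<Rightarrow> 'a set \<Rightarrow> bool" where
  "kempe_closed E c \<alpha> \<beta> S \<longleftrightarrow> (\<forall>e\<in>E. c e \<in> {\<alpha>, \<beta>} \<and> e \<inter> S \<noteq> {} \<longrightarrow> e \<subseteq> S)"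

text \<open>No test on the colour is made: an edge of a third colour that meets \<open>S\<close> is
  fixed by the transposition.\<close>

definition kempe_swap :: "'a set \<Rightarrow> 'c \<Rightarrow> 'c \<Rightarrow> ('a set \<Rightarrow> 'c) \<Rightarrow> 'a set \<Rightarrow> 'c" where
  "kempe_swap S \<alpha> \<beta> c e = (if e \<inter> S \<noteq> {} then transpose \<alpha> \<beta> (c e) else c e)"

lemma properD: "proper E c \<Longrightarrow> e \<in> E \<Longrightarrow> f \<in> E \<Longrightarrow> v \<in> e \<Longrightarrow> v \<in> f \<Longrightarrow> c e = c f \<Longrightarrow> e = f"
  unfolding proper_def by blast

lemma kempe_closed_Compl: "kempe_closed E c \<alpha> \<beta> S \<Longrightarrow> kempe_closed E c \<alpha> \<beta> (- S)"
  unfolding kempe_closed_def by blast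

lemma kempe_swap_meets:
  assumes "kempe_closed E c \<alpha> \<beta> S" "e \<in> E" "v \<in> e" "v \<in> S"
  shows "kempe_swap S \<alpha> \<beta> c e = transpose \<alpha> \<beta> (c e)"
  using assms unfolding kempe_swap_def by auto

lemma kempe_swap_avoids:
  assumes "kempe_closed E c \<alpha> \<beta> S" "e \<in> E" "v \<in> e" "v \<notin> S"
  shows "kempe_swap S \<alpha> \<beta> c e = c e"
proof (cases "e \<inter> S = {}")
  case False
  then have "c e \<notin> {\<alpha>, \<beta>}"
    using assms unfolding kempe_closed_def by blast
  then show ?thesis
    by (simp add: kempe_swap_def)
qed (simp add: kempe_swap_def)

text \<open>At a common vertex of two edges the colours are both transposed or both kept, depending
  only on whether that vertex lies in \<open>S\<close>; either map is injective.\<close>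

lemma proper_kempe_swap:
  assumes "proper E c" "kempe_closed E c \<alpha> \<beta> S"
  shows "proper E (kempe_swap S \<alpha> \<beta> c)"
  unfolding proper_def
proof (intro ballI impI)
  fix e f assume ef: "e \<in> E" "f \<in> E" "e \<noteq> f \<and> e \<inter> f \<noteq> {}"
  then obtain v where v: "v \<in> e" "v \<in> f" by blast
  have "c e \<noteq> c f"
    using assms(1) ef unfolding proper_def by blast
  then show "kempe_swap S \<alpha> \<beta> c e \<noteq> kempe_swap S \<alpha> \<beta> c f"
    using kempe_swap_meets[OF assms(2)] kempe_swap_avoids[OF assms(2)] ef v
    by (cases "v \<in> S") (auto simp: transpose_eq_iff)
qed

lemma misses_kempe_swap:
  assumes "kempe_closed E c \<alpha> \<beta> S"
  shows "misses E (kempe_swap S \<alpha> \<beta> c) v \<gamma> \<longleftrightarrow> misses E c v (if v \<in> S then transpose \<alpha> \<beta> \<gamma> else \<gamma>)"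
proof -
  have "kempe_swap S \<alpha> \<beta> c e \<noteq> \<gamma> \<longleftrightarrow> c e \<noteq> (if v \<in> S then transpose \<alpha> \<beta> \<gamma> else \<gamma>)" if "e \<in> E" "v \<in> e" for e
  proof (cases "v \<in> S")
    case True
    then show ?thesis
      using kempe_swap_meets[OF assms that True] by (metis transpose_involutory)
  qed (use kempe_swap_avoids[OF assms that] in simp)
  then show ?thesis
    unfolding misses_def by blast
qed

lemma kempe_swap_image:
  assumes "c ` E \<subseteq> C" "\<alpha> \<in> C" "\<beta> \<in> C"
  shows "kempe_swap S \<alpha> \<beta> c ` E \<subseteq> C"
  using assms by (auto simp: kempe_swap_def transpose_def)

text \<open>The chain is walked deterministically by states consisting of a vertex and the colour of
  the edge to be followed next; a vertex missing one of the two colours is a dead end of the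
  walk, and a deterministic walk has at most one dead end.\<close>
lemma kempe_chain:
  assumes pr: "proper E c" and card2: "\<And>e. e \<in> E \<Longrightarrow> card e = 2"
    and u: "misses E c u \<beta>" and ne: "\<alpha> \<noteq> \<beta>"
  obtains S where "u \<in> S" "kempe_closed E c \<alpha> \<beta> S"
    "\<And>v w. \<lbrakk>v \<in> S; w \<in> S; v \<noteq> u; w \<noteq> u; misses E c v \<alpha> \<or> misses E c v \<beta>;
      misses E c w \<alpha> \<or> misses E c w \<beta>\<rbrakk> \<Longrightarrow> v = w"
proof -
  define r where "r = {((v, \<gamma>), (w, \<delta>)) | v \<gamma> w \<delta>.
    {v, w} \<in> E \<and> c {v, w} = \<gamma> \<and> \<gamma> \<in> {\<alpha>, \<beta>} \<and> \<delta> = transpose \<alpha> \<beta> \<gamma>}"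
  have r_iff: "((v, \<gamma>), (w, \<delta>)) \<in> r \<longleftrightarrow>
      {v, w} \<in> E \<and> c {v, w} = \<gamma> \<and> \<gamma> \<in> {\<alpha>, \<beta>} \<and> \<delta> = transpose \<alpha> \<beta> \<gamma>" for v \<gamma> w \<delta>
    unfolding r_def by blast
  have "single_valued r"
  proof (rule single_valuedI, clarify)
    fix v w w' \<gamma> \<delta> \<delta>' assume *: "((v, \<gamma>), (w, \<delta>)) \<in> r" "((v, \<gamma>), (w', \<delta>')) \<in> r"
    then have "{v, w} = {v, w'}"
      using properD[OF pr, of "{v, w}" "{v, w'}" v] unfolding r_iff by simp
    then show "w = w' \<and> \<delta> = \<delta>'"
      using * unfolding r_iff by (auto simp: doubleton_eq_iff)
  qed
  \<comment> \<open>The walk starts with \<alpha> because \<open>u\<close> misses \<beta>: an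
    \<alpha>-edge is the only way out of \<open>u\<close>.\<close>
  define S where "S = {v. \<exists>\<gamma>. ((u, \<alpha>), (v, \<gamma>)) \<in> r\<^sup>*}"
  \<comment> \<open>Every state other than the start was entered through an edge of the other of the
    two colours.\<close>
  have arrive: "(v = u \<and> \<gamma> = \<alpha>) \<or> (\<exists>p\<in>S. {p, v} \<in> E \<and> c {p, v} = transpose \<alpha> \<beta> \<gamma> \<and> \<gamma> \<in> {\<alpha>, \<beta>})"
    if "((u, \<alpha>), (v, \<gamma>)) \<in> r\<^sup>*" for v \<gamma>
    using that
  proof (cases rule: rtranclE)
    case (step s)
    obtain p \<delta> where "s = (p, \<delta>)" by (cases s)
    then show ?thesis
      using step ne unfolding S_def by (auto simp: r_iff)
  qed auto
  have "u \<in> S"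
    unfolding S_def by blast
  moreover have "kempe_closed E c \<alpha> \<beta> S"
    unfolding kempe_closed_def
  proof (intro ballI impI)
    fix e assume e: "e \<in> E" "c e \<in> {\<alpha>, \<beta>} \<and> e \<inter> S \<noteq> {}"
    then obtain v where v: "v \<in> e" "v \<in> S" by blast
    obtain w where w: "e = {v, w}"
      using card2[OF e(1)] v(1) by (auto simp: card_2_iff)
    obtain \<gamma> where \<gamma>: "((u, \<alpha>), (v, \<gamma>)) \<in> r\<^sup>*"
      using v(2) unfolding S_def by blast
    \<comment> \<open>Either \<open>e\<close> is the edge that the walk follows next from
      \<open>v\<close>, or it is the edge by which \<open>v\<close> was entered. At the start state
      the second case would need a \<beta>-edge at \<open>u\<close>.\<close>
    have "w \<in> S"
    proof (cases "c e = \<gamma>")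
      case True
      then have "((v, \<gamma>), (w, transpose \<alpha> \<beta> \<gamma>)) \<in> r"
        using e w unfolding r_iff by blast
      then show ?thesis
        using \<gamma> unfolding S_def by (blast intro: rtrancl_into_rtrancl)
    next
      case False
      then have "\<not> (v = u \<and> \<gamma> = \<alpha>)"
        using u e v unfolding misses_def by blast
      then obtain p where p: "p \<in> S" "{p, v} \<in> E" "c {p, v} = transpose \<alpha> \<beta> \<gamma>" "\<gamma> \<in> {\<alpha>, \<beta>}"
        using arrive[OF \<gamma>] by blast
      then have "c {p, v} = c e"
        using False e(2) by auto
      then have "{p, v} = e"
        using properD[OF pr p(2) e(1), of v] v(1) by simp
      then show ?thesis
        using p(1) w by (auto simp: doubleton_eq_iff)
    qed
    then show "e \<subseteq> S"
      using v w by blast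
  qed
  moreover have "v = w" if "v \<in> S" "w \<in> S" "v \<noteq> u" "w \<noteq> u"
    "misses E c v \<alpha> \<or> misses E c v \<beta>" "misses E c w \<alpha> \<or> misses E c w \<beta>" for v w
  proof -
    \<comment> \<open>The colour through which \<open>v\<close> was entered occurs at
      \<open>v\<close>, so the missing one is the colour to be followed next.\<close>
    have dead_end: "\<exists>\<gamma>. ((u, \<alpha>), (v, \<gamma>)) \<in> r\<^sup>* \<and> (v, \<gamma>) \<notin> Domain r"
      if v: "v \<in> S" "v \<noteq> u" "misses E c v \<alpha> \<or> misses E c v \<beta>" for v
    proof -
      obtain \<gamma> where \<gamma>: "((u, \<alpha>), (v, \<gamma>)) \<in> r\<^sup>*"
        using v(1) unfolding S_def by blast
      then obtain p where "{p, v} \<in> E" "c {p, v} = transpose \<alpha> \<beta> \<gamma>" "\<gamma> \<in> {\<alpha>, \<beta>}"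
        using arrive v(2) by blast
      then have "misses E c v \<gamma>"
        using v(3) by (auto simp: misses_def)
      then have "(v, \<gamma>) \<notin> Domain r"
        by (auto simp: r_iff misses_def)
      then show ?thesis
        using \<gamma> by blast
    qed
    obtain \<gamma> where \<gamma>: "((u, \<alpha>), (v, \<gamma>)) \<in> r\<^sup>*" "(v, \<gamma>) \<notin> Domain r"
      using dead_end \<open>v \<in> S\<close> \<open>v \<noteq> u\<close> \<open>misses E c v \<alpha> \<or> misses E c v \<beta>\<close> by blast
    obtain \<delta> where \<delta>: "((u, \<alpha>), (w, \<delta>)) \<in> r\<^sup>*" "(w, \<delta>) \<notin> Domain r"
      using dead_end \<open>w \<in> S\<close> \<open>w \<noteq> u\<close> \<open>misses E c w \<alpha> \<or> misses E c w \<beta>\<close> by blast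
    \<comment> \<open>Confluence gives a common successor, and a state without outgoing step reaches
      only itself.\<close>
    have "(v, \<gamma>) = (w, \<delta>)"
      using single_valued_confluent[OF \<open>single_valued r\<close> \<gamma>(1) \<delta>(1)] \<gamma>(2) \<delta>(2)
      by (metis Not_Domain_rtrancl)
    then show "v = w" by simp
  qed
  ultimately show ?thesis
    using that by blast
qed

section \<open>Vizing fans\<close>

text \<open>A fan at \<open>x\<close>: the edge to the head of the list is uncoloured, and the colour of every
  further spoke is missing at the preceding vertex of the list.\<close>
definition fan :: "'a set set \<Rightarrow> ('a set \<Rightarrow> 'c) \<Rightarrow> 'a \<Rightarrow> 'a list \<Rightarrow> bool" where
  "fan E c x ys \<longleftrightarrow> ys \<noteq> [] \<and> distinct ys \<and> x \<notin> set ys \<and> (\<forall>y\<in>set ys. {x, y} \<in> E) \<and>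
     proper (E - {{x, hd ys}}) c \<and>
     successively (\<lambda>p q. misses (E - {{x, hd ys}}) c p (c {x, q})) ys"

text \<open>The second entry of a consecutive pair is never the head. This matters when a Kempe swap
  is shown to keep a fan intact, where the spoke to the head carries \<beta> and the argument holds
  only for the later spokes.\<close>

lemma successively_mem_tl:
  "successively P (z # zs) \<Longrightarrow> successively (\<lambda>p q. P p q \<and> p \<in> set (z # zs) \<and> q \<in> set zs) (z # zs)"
proof (induction zs arbitrary: z)
  case (Cons a zs)
  then show ?case
    by (auto intro: successively_mono)
qed simp

text \<open>Rotation by one spoke: the colour of \<open>{x, z}\<close> is missing at
  \<open>y\<close>, so it can move to \<open>{x, y}\<close>, leaving \<open>{x, z}\<close>
  uncoloured. The colours seen at \<open>x\<close> stay the same, and no vertex of the remaining fan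
  sees a new one.\<close>

lemma fan_step:
  assumes fan: "fan E c x (y # z # zs)"
  defines "c' \<equiv> c({x, y} := c {x, z})"
  shows "fan E c' x (z # zs)"
    and "misses (E - {{x, y}}) c x \<gamma> \<Longrightarrow> misses (E - {{x, z}}) c' x \<gamma>"
    and "w \<in> set (z # zs) \<Longrightarrow> misses (E - {{x, y}}) c w \<gamma> \<Longrightarrow> misses (E - {{x, z}}) c' w \<gamma>"
    and "w \<in> set (z # zs) \<Longrightarrow> c' {x, w} = c {x, w}"
    and "c' ` (E - {{x, z}}) \<subseteq> c ` (E - {{x, y}})"
proof -
  have y: "x \<noteq> y" "y \<notin> set (z # zs)" "{x, y} \<in> E" and z: "x \<noteq> z" "{x, z} \<in> E"
    and d: "distinct (z # zs)" "x \<notin> set (z # zs)" "\<forall>y\<in>set (z # zs). {x, y} \<in> E"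
    and pr: "proper (E - {{x, y}}) c"
    and ymiss: "misses (E - {{x, y}}) c y (c {x, z})"
    and succ: "successively (\<lambda>p q. misses (E - {{x, y}}) c p (c {x, q})) (z # zs)"
    using fan unfolding fan_def by auto
  have xz: "{x, z} \<in> E - {{x, y}}"
    using y z by (auto simp: doubleton_eq_iff)
  show keep: "c' {x, w} = c {x, w}" if "w \<in> set (z # zs)" for w
    using that y by (auto simp: c'_def doubleton_eq_iff)
  show m: "misses (E - {{x, z}}) c' w \<gamma>" if "w \<in> set (z # zs)" "misses (E - {{x, y}}) c w \<gamma>" for w \<gamma>
  proof -
    have "w \<notin> {x, y}"
      using that y d by auto
    then show ?thesis
      using that(2) unfolding misses_def c'_def by auto
  qed
  show "misses (E - {{x, z}}) c' x \<gamma>" if "misses (E - {{x, y}}) c x \<gamma>"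
    using that xz unfolding misses_def c'_def by auto
  show "c' ` (E - {{x, z}}) \<subseteq> c ` (E - {{x, y}})"
    using xz by (auto simp: c'_def)
  \<comment> \<open>The moved colour clashes with no other edge: at \<open>y\<close> by the fan
    condition, at \<open>x\<close> because properness allows it only on
    \<open>{x, z}\<close>.\<close>
  have new: "c e \<noteq> c {x, z}" if "e \<in> E - {{x, z}}" "e \<noteq> {x, y}" "e \<inter> {x, y} \<noteq> {}" for e
  proof (cases "y \<in> e")
    case True
    then show ?thesis
      using ymiss that unfolding misses_def by blast
  next
    case False
    then have "x \<in> e" using that by blast
    then show ?thesis
      using properD[OF pr _ xz, of e x] that by blast
  qed
  have "proper (E - {{x, z}}) c'"
    unfolding proper_def
  proof (intro ballI impI)
    fix e f assume ef: "e \<in> E - {{x, z}}" "f \<in> E - {{x, z}}" "e \<noteq> f \<and> e \<inter> f \<noteq> {}"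
    consider "e = {x, y}" | "f = {x, y}" | "e \<noteq> {x, y}" "f \<noteq> {x, y}" by blast
    then show "c' e \<noteq> c' f"
    proof cases
      case 1
      then have "c f \<noteq> c {x, z}"
        using new[of f] ef by blast
      then show ?thesis
        using 1 ef by (auto simp: c'_def)
    next
      case 2
      then have "c e \<noteq> c {x, z}"
        using new[of e] ef by blast
      then show ?thesis
        using 2 ef by (auto simp: c'_def)
    next
      case 3
      then show ?thesis
        using pr ef unfolding proper_def c'_def by auto
    qed
  qed
  moreover have "successively (\<lambda>p q. misses (E - {{x, z}}) c' p (c' {x, q})) (z # zs)"
    by (rule successively_mono[OF succ]) (simp only: m keep)
  ultimately show "fan E c' x (z # zs)"
    using d unfolding fan_def by simp
qed

text \<open>Iterated rotation until \<open>{x, y}\<close> is the uncoloured spoke, by induction on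
  the prefix. Writing the old head as \<open>hd (as @ [y])\<close> includes the empty prefix, where
  \<open>y\<close> itself is the head.\<close>

lemma fan_shift:
  assumes "fan E c x (as @ y # bs)"
  defines "h \<equiv> hd (as @ [y])"
  shows "\<exists>c'. fan E c' x (y # bs) \<and>
    (\<forall>\<gamma>. misses (E - {{x, h}}) c x \<gamma> \<longrightarrow> misses (E - {{x, y}}) c' x \<gamma>) \<and>
    (\<forall>w\<in>set (y # bs). \<forall>\<gamma>. misses (E - {{x, h}}) c w \<gamma> \<longrightarrow> misses (E - {{x, y}}) c' w \<gamma>) \<and>
    (\<forall>w\<in>set bs. c' {x, w} = c {x, w}) \<and>
    c' ` (E - {{x, y}}) \<subseteq> c ` (E - {{x, h}})"
  using assms(1) unfolding h_def
proof (induction as arbitrary: c)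
  case Nil
  then show ?case by (intro exI[of _ c]) auto
next
  case (Cons a as)
  obtain z zs where zs: "as @ y # bs = z # zs" "hd (as @ [y]) = z"
    by (cases as) auto
  have sub: "set (y # bs) \<subseteq> set (z # zs)"
    unfolding zs(1)[symmetric] by auto
  let ?c = "c({x, a} := c {x, z})"
  have fan: "fan E c x (a # z # zs)"
    using Cons.prems zs by simp
  note step = fan_step[OF fan]
  have "fan E ?c x (as @ y # bs)"
    using step(1) zs(1) by simp
  note IH = Cons.IH[OF this, unfolded zs(2)]
  obtain c' where c': "fan E c' x (y # bs)"
    "\<forall>\<gamma>. misses (E - {{x, z}}) ?c x \<gamma> \<longrightarrow> misses (E - {{x, y}}) c' x \<gamma>"
    "\<forall>w\<in>set (y # bs). \<forall>\<gamma>. misses (E - {{x, z}}) ?c w \<gamma> \<longrightarrow> misses (E - {{x, y}}) c' w \<gamma>"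
    "\<forall>w\<in>set bs. c' {x, w} = ?c {x, w}"
    "c' ` (E - {{x, y}}) \<subseteq> ?c ` (E - {{x, z}})"
    using IH by (elim exE conjE) (rule that)
  have "c' {x, w} = c {x, w}" if "w \<in> set bs" for w
    using bspec[OF c'(4) that] step(4)[of w] sub that by auto
  moreover have "misses (E - {{x, y}}) c' w \<gamma>" if "w \<in> set (y # bs)" "misses (E - {{x, a}}) c w \<gamma>" for w \<gamma>
    using bspec[OF c'(3) that(1)] step(3)[OF _ that(2)] sub that(1) by blast
  ultimately show ?case
    using c'(1,2) step(2) subset_trans[OF c'(5) step(5)]
    by (intro exI[of _ c'] conjI) simp_all
qed

lemma proper_extend:
  assumes "proper (E - {{x, y}}) c" "misses (E - {{x, y}}) c x \<gamma>" "misses (E - {{x, y}}) c y \<gamma>"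
  shows "proper E (c({x, y} := \<gamma>))"
  unfolding proper_def
proof (intro ballI impI)
  fix e f assume ef: "e \<in> E" "f \<in> E" "e \<noteq> f \<and> e \<inter> f \<noteq> {}"
  have "c g \<noteq> \<gamma>" if "g \<in> E" "g \<noteq> {x, y}" "g \<inter> {x, y} \<noteq> {}" for g
    using assms(2,3) that unfolding misses_def by blast
  then show "(c({x, y} := \<gamma>)) e \<noteq> (c({x, y} := \<gamma>)) f"
    using assms(1) ef unfolding proper_def by (auto simp: Int_commute)
qed

text \<open>Rotating the whole fan leaves only the last spoke uncoloured, and \<gamma> is still
  missing at both of its ends.\<close>

lemma fan_color:
  assumes "fan E c x ys" "misses (E - {{x, hd ys}}) c x \<gamma>" "misses (E - {{x, hd ys}}) c (last ys) \<gamma>"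
    and "c ` (E - {{x, hd ys}}) \<subseteq> C" "\<gamma> \<in> C"
  shows "\<exists>c'. proper E c' \<and> c' ` E \<subseteq> C"
proof -
  have ys: "ys = butlast ys @ [last ys]"
    using assms(1) unfolding fan_def by simp
  obtain c' where "fan E c' x [last ys]" "misses (E - {{x, last ys}}) c' x \<gamma>"
    "misses (E - {{x, last ys}}) c' (last ys) \<gamma>"
    "c' ` (E - {{x, last ys}}) \<subseteq> c ` (E - {{x, hd ys}})"
    using fan_shift[of E c x "butlast ys" "last ys" "[]"] assms(1-3) unfolding ys[symmetric]
    by auto
  then show ?thesis
    using proper_extend[of E x "last ys" c' \<gamma>] assms(4,5)
    by (intro exI[of _ "c'({x, last ys} := \<gamma>)"]) (auto simp: fan_def)
qed

section \<open>Vizing's extension step\<close>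

lemma exists_missing:
  assumes "finite F" "finite C" "card {e \<in> F. v \<in> e} < card C"
  obtains \<gamma> where "\<gamma> \<in> C" "misses F c v \<gamma>"
proof -
  have "card (c ` {e \<in> F. v \<in> e}) < card C"
    using assms card_image_le[of "{e \<in> F. v \<in> e}" c] by simp
  then have "\<not> C \<subseteq> c ` {e \<in> F. v \<in> e}"
    using card_mono[of "c ` {e \<in> F. v \<in> e}" C] assms(1) by auto
  then show ?thesis
    using that unfolding misses_def by blast
qed

text \<open>With more colours than any degree, every vertex misses a colour. Take a longest fan at
  \<open>x\<close> and a colour \<beta> missing at its last vertex. If \<open>x\<close> misses
  \<beta> too, rotating the fan finishes; otherwise the \<beta>-edge at \<open>x\<close> ends inside
  the fan, and a Kempe swap makes some colour free at both ends of a suitable spoke.\<close>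

lemma vizing_extension:
  assumes fin: "finite E" "finite C" and card2: "\<And>e. e \<in> E \<Longrightarrow> card e = 2"
    and deg: "\<And>v. card {e \<in> E. v \<in> e} < card C"
    and e0: "e0 \<in> E" and pr: "proper (E - {e0}) c" and img: "c ` (E - {e0}) \<subseteq> C"
  shows "\<exists>c'. proper E c' \<and> c' ` E \<subseteq> C"
proof -
  obtain x y0 where xy0: "e0 = {x, y0}" "x \<noteq> y0"
    using card2[OF e0] by (auto simp: card_2_iff)
  have missing: "\<exists>\<gamma>\<in>C. misses (E - {e}) c v \<gamma>" for v e c
  proof -
    have "card {e' \<in> E - {e}. v \<in> e'} \<le> card {e \<in> E. v \<in> e}"
      using fin by (intro card_mono) auto
    then show ?thesis
      using exists_missing[of "E - {e}" C v c] fin deg[of v] by fastforce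
  qed
  define isfan where "isfan ys \<longleftrightarrow> fan E c x ys \<and> hd ys = y0" for ys
  have "isfan [y0]"
    using e0 pr xy0 unfolding isfan_def fan_def by simp
  \<comment> \<open>Fans are compared by length for the fixed colouring \<open>c\<close>; their
    vertices are distinct ends of edges, so a longest one exists.\<close>
  moreover have "length ys < Suc (card (\<Union>E))" if "isfan ys" for ys
  proof -
    have "set ys \<subseteq> \<Union>E" "distinct ys"
      using that unfolding isfan_def fan_def by auto
    moreover have "finite (\<Union>E)"
      using fin(1) by (rule finite_Union) (simp add: card2 card_ge_0_finite)
    ultimately show ?thesis
      by (metis card_mono distinct_card less_Suc_eq_le)
  qed
  ultimately obtain ys where ys: "isfan ys" and maxi: "\<And>zs. isfan zs \<Longrightarrow> length zs \<le> length ys"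
    using ex_has_greatest_nat[of isfan "[y0]" length "Suc (card (\<Union>E))"] by blast
  have fan: "fan E c x ys" and hd: "hd ys = y0"
    using ys unfolding isfan_def by auto
  obtain \<alpha> where \<alpha>: "\<alpha> \<in> C" "misses (E - {e0}) c x \<alpha>"
    using missing by blast
  obtain \<beta> where \<beta>: "\<beta> \<in> C" "misses (E - {e0}) c (last ys) \<beta>"
    using missing by blast
  show ?thesis
  proof (cases "misses (E - {e0}) c x \<beta>")
    case True
    then show ?thesis
      using fan_color[OF fan] \<beta> img unfolding hd xy0 by blast
  next
    case False
    then obtain e where e: "e \<in> E" "e \<noteq> e0" "x \<in> e" "c e = \<beta>"
      unfolding misses_def by blast
    then obtain z where z: "e = {x, z}" "x \<noteq> z"
      using card2[OF e(1)] by (auto simp: card_2_iff)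
    \<comment> \<open>Otherwise \<open>z\<close> could be appended, since the colour \<beta> of
      \<open>{x, z}\<close> is missing at the last vertex.\<close>
    have "z \<in> set ys"
    proof (rule ccontr)
      assume "z \<notin> set ys"
      then have "isfan (ys @ [z])"
        using ys e z \<beta>(2) xy0 unfolding isfan_def fan_def by (auto simp: successively_append_iff)
      then show False
        using maxi by fastforce
    qed
    moreover have "z \<noteq> hd ys"
      using e z xy0 hd by auto
    \<comment> \<open>The predecessor \<open>y\<close> of \<open>z\<close> misses \<beta>, by the
      fan condition. It exists because \<open>{x, z}\<close> is coloured and hence is not the spoke
      to the head.\<close>
    ultimately obtain as y bs where asbs: "ys = as @ y # z # bs"
    proof -
      obtain as' bs where *: "ys = as' @ z # bs"
        using \<open>z \<in> set ys\<close> by (meson split_list)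
      then have "as' \<noteq> []"
        using \<open>z \<noteq> hd ys\<close> by auto
      then have "ys = butlast as' @ last as' # z # bs"
        using * by simp
      then show ?thesis using that by blast
    qed
    have hd': "hd (as @ [y]) = y0"
      using hd asbs by (cases as) auto
    let ?F = "E - {{x, y}}"
    \<comment> \<open>Rotating up to \<open>y\<close> makes \<open>{x, y}\<close> the uncoloured
      edge. Now \<beta> is missing both at \<open>y\<close> and at the last vertex, and \<alpha> at
      \<open>x\<close>.\<close>
    obtain c1 where fan1: "fan E c1 x (y # z # bs)"
      and m1: "misses ?F c1 x \<alpha>" "misses ?F c1 (last (z # bs)) \<beta>"
      and z1: "c1 {x, z} = \<beta>" and img1: "c1 ` ?F \<subseteq> C"
    proof -
      have "fan E c x (as @ y # z # bs)"
        using fan asbs by simp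
      note shift = fan_shift[OF this, unfolded hd', folded xy0(1)]
      obtain c1 where c1: "fan E c1 x (y # z # bs)"
        "\<forall>\<gamma>. misses (E - {e0}) c x \<gamma> \<longrightarrow> misses ?F c1 x \<gamma>"
        "\<forall>w\<in>set (y # z # bs). \<forall>\<gamma>. misses (E - {e0}) c w \<gamma> \<longrightarrow> misses ?F c1 w \<gamma>"
        "\<forall>w\<in>set (z # bs). c1 {x, w} = c {x, w}"
        "c1 ` ?F \<subseteq> c ` (E - {e0})"
        using shift by (elim exE conjE) (rule that)
      have "last (z # bs) \<in> set (y # z # bs)" by auto
      moreover have "last ys = last (z # bs)"
        using asbs by simp
      ultimately have "misses ?F c1 (last (z # bs)) \<beta>"
        using bspec[OF c1(3), of "last (z # bs)"] \<beta>(2) by metis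
      then show ?thesis
        using that[OF c1(1)] c1(2) \<alpha>(2) bspec[OF c1(4), of z] subset_trans[OF c1(5) img] e(4) z(1)
        by simp
    qed
    have pr1: "proper ?F c1" and d1: "distinct (y # z # bs)" "x \<notin> set (y # z # bs)"
      and sp1: "\<And>w. w \<in> set (y # z # bs) \<Longrightarrow> {x, w} \<in> E"
      and y1: "misses ?F c1 y \<beta>"
      and succ1: "successively (\<lambda>p q. misses ?F c1 p (c1 {x, q})) (z # bs)"
      using fan1 z1 unfolding fan_def by auto
    have spoke: "{x, w} \<in> ?F" if "w \<in> set (z # bs)" for w
      using sp1 d1 that by (auto simp: doubleton_eq_iff)
    have ne: "\<alpha> \<noteq> \<beta>"
      using m1(1) z1 spoke[of z] unfolding misses_def by auto
    have card2': "\<And>e. e \<in> ?F \<Longrightarrow> card e = 2"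
      using card2 by blast
    obtain S where S: "y \<in> S" "kempe_closed ?F c1 \<alpha> \<beta> S"
      "\<And>v w. \<lbrakk>v \<in> S; w \<in> S; v \<noteq> y; w \<noteq> y; misses ?F c1 v \<alpha> \<or> misses ?F c1 v \<beta>;
        misses ?F c1 w \<alpha> \<or> misses ?F c1 w \<beta>\<rbrakk> \<Longrightarrow> v = w"
      using kempe_chain[OF pr1 card2' y1 ne] by blast
    txt \<open>The chain from \<open>y\<close> contains at most one of \<open>x\<close> and the last vertex of the fan.
      If it avoids \<open>x\<close>, swapping on it frees \<open>\<alpha>\<close> at \<open>y\<close>; otherwise swapping off it frees \<open>\<alpha>\<close>
      at the last vertex and leaves the fan from \<open>y\<close> on intact.\<close>
    show ?thesis
    proof (cases "x \<in> S")
      case False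
      let ?c2 = "kempe_swap S \<alpha> \<beta> c1"
      have "misses ?F ?c2 x \<alpha>" "misses ?F ?c2 y \<alpha>"
        using False S(1) m1 y1 by (simp_all add: misses_kempe_swap[OF S(2)])
      moreover have "proper ?F ?c2"
        using proper_kempe_swap[OF pr1 S(2)] .
      moreover have "?c2 ` ?F \<subseteq> C"
        using kempe_swap_image[OF img1 \<alpha>(1) \<beta>(1)] .
      ultimately show ?thesis
        using proper_extend[of E x y ?c2 \<alpha>] \<alpha>(1)
        by (intro exI[of _ "?c2({x, y} := \<alpha>)"]) auto
    next
      case True
      let ?l = "last (z # bs)"
      let ?c2 = "kempe_swap (- S) \<alpha> \<beta> c1"
      note closed = kempe_closed_Compl[OF S(2)]
      have l: "?l \<in> set (z # bs)" by (rule last_in_set) simp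
      then have "?l \<noteq> x" "?l \<noteq> y"
        using d1 by auto
      then have "?l \<notin> S"
        using S(3)[of ?l x] True m1 d1 by auto
      then have last2: "misses ?F ?c2 ?l \<alpha>"
        using m1(2) by (simp add: misses_kempe_swap[OF closed])
      have x2: "misses ?F ?c2 x \<alpha>"
        using m1(1) True by (simp add: misses_kempe_swap[OF closed])
      have spoke2: "?c2 {x, w} = c1 {x, w}" if "w \<in> set (z # bs)" for w
        using kempe_swap_avoids[OF closed spoke[OF that], of x] True by simp
      \<comment> \<open>As \<open>y\<close> lies in \<open>S\<close>, the swap on \<open>- S\<close>
        leaves \<beta> missing there; as \<open>x\<close> lies in \<open>S\<close>, the spoke
        \<open>{x, z}\<close> keeps its colour \<beta>.\<close>
      have y2: "misses ?F ?c2 y (?c2 {x, z})"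
        using y1 z1 S(1) spoke2[of z] by (simp add: misses_kempe_swap[OF closed])
      \<comment> \<open>A spoke beyond \<open>z\<close> has neither swapped colour: \<alpha> is
        missing at \<open>x\<close>, and \<beta> is taken by \<open>{x, z}\<close>. Its colour is
        therefore missing at \<open>p\<close> after the swap as before.\<close>
      have succ2: "misses ?F ?c2 p (?c2 {x, q})"
        if "misses ?F c1 p (c1 {x, q})" "q \<in> set bs" for p q
      proof -
        have "c1 {x, q} \<noteq> \<alpha>"
          using m1(1) spoke[of q] that(2) unfolding misses_def by auto
        moreover have "c1 {x, q} \<noteq> \<beta>"
        proof
          assume "c1 {x, q} = \<beta>"
          then have "{x, q} = {x, z}"
            using properD[OF pr1 spoke spoke, of q z x] z1 that(2) by simp
          then show False
            using that(2) d1 by (auto simp: doubleton_eq_iff)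
        qed
        ultimately show ?thesis
          using that spoke2[of q] by (simp add: misses_kempe_swap[OF closed])
      qed
      have "successively (\<lambda>p q. misses ?F ?c2 p (?c2 {x, q})) (z # bs)"
        by (rule successively_mono[OF successively_mem_tl[OF succ1]]) (use succ2 in blast)
      then have "fan E ?c2 x (y # z # bs)"
        using proper_kempe_swap[OF pr1 closed] d1 sp1 y2 unfolding fan_def by simp
      then show ?thesis
        using fan_color[of E ?c2 x "y # z # bs" \<alpha> C] x2 last2 \<alpha>(1)
          kempe_swap_image[OF img1 \<alpha>(1) \<beta>(1)] by simp
    qed
  qed
qed

section \<open>Rainbow cuts around vertices\<close>

lemma parcs_eq_edges:
  assumes "pair_graph G"
  shows "(u, v) \<in> parcs G \<longleftrightarrow> {u, v} \<in> edges G"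
proof -
  interpret pair_graph G by fact
  have "sym (parcs G)"
    using pair_sym_arcs unfolding symmetric_def by simp
  then show ?thesis
    unfolding edges_def by (auto simp: doubleton_eq_iff dest: symD)
qed

lemma finite_edges:
  assumes "pair_graph G"
  shows "finite (edges G)"
proof -
  interpret pair_graph G by fact
  have "edges G = (\<lambda>(u, v). {u, v}) ` parcs G"
    unfolding edges_def by auto
  then show ?thesis
    using pair_finite_arcs by simp
qed

lemma card_edge:
  assumes "pair_graph G" "e \<in> edges G"
  shows "card e = 2"
proof -
  interpret pair_graph G by fact
  show ?thesis
    using assms(2) pair_no_loops unfolding edges_def by fastforce
qed

lemma edge_subset_verts:
  assumes "pair_graph G" "e \<in> edges G"
  shows "e \<subseteq> pverts G"
proof -
  interpret pair_graph G by fact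
  show ?thesis
    using assms(2) unfolding edges_def by (auto dest: in_arcsD1 in_arcsD2)
qed

lemma out_degree_eq_card_star:
  assumes "pair_graph G"
  shows "out_degree (with_proj G) v = card {e \<in> edges G. v \<in> e}"
proof -
  have "bij_betw (\<lambda>a. {fst a, snd a}) (out_arcs (with_proj G) v) {e \<in> edges G. v \<in> e}"
  proof (rule bij_betw_imageI)
    show "inj_on (\<lambda>a. {fst a, snd a}) (out_arcs (with_proj G) v)"
      by (auto simp: inj_on_def doubleton_eq_iff)
    show "(\<lambda>a. {fst a, snd a}) ` out_arcs (with_proj G) v = {e \<in> edges G. v \<in> e}"
    proof (intro set_eqI iffI)
      fix e assume "e \<in> {e \<in> edges G. v \<in> e}"
      then obtain a b where "(a, b) \<in> parcs G" "e = {a, b}" "v \<in> {a, b}"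
        unfolding edges_def by auto
      then obtain w where w: "e = {v, w}" by auto
      then have "(v, w) \<in> parcs G"
        using \<open>e \<in> _\<close> parcs_eq_edges[OF assms, of v w] by blast
      then show "e \<in> (\<lambda>a. {fst a, snd a}) ` out_arcs (with_proj G) v"
        using w by (intro image_eqI[of _ _ "(v, w)"]) auto
    qed (use parcs_eq_edges[OF assms] in auto)
  qed
  then show ?thesis
    unfolding out_degree_def by (rule bij_betw_same_card)
qed

text \<open>Outside the vertex set the star is empty, so the bound holds for every \<open>v\<close>,
  as the degree hypothesis of \<open>vizing_extension\<close> demands.\<close>

lemma card_star_le_max_degree:
  assumes "pair_graph G"
  shows "card {e \<in> edges G. v \<in> e} \<le> max_degree G"
proof (cases "v \<in> pverts G")
  case True
  interpret pair_graph G by fact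
  show ?thesis
    unfolding max_degree_def out_degree_eq_card_star[OF assms, symmetric]
    using True pair_finite_verts by (intro Max_ge) auto
next
  case False
  then have "{e \<in> edges G. v \<in> e} = {}"
    using edge_subset_verts[OF assms] by blast
  then show ?thesis by (simp only: card.empty)
qed

section \<open>Proper colourings and the chromatic index\<close>

lemma proper_edge_coloring_iff:
  "proper_edge_coloring G k c \<longleftrightarrow> c ` edges G \<subseteq> {1..k} \<and> proper (edges G) c"
  unfolding proper_edge_coloring_def edge_coloring_def proper_def by blast

lemma edges_delete_edge:
  "edges (delete_edges G {e}) = edges G - {e}"
  unfolding edges_def delete_edges_def by auto

text \<open>Giving all edges distinct colours shows that the minimum ranges over a nonempty set, so
  it is attained.\<close>

lemma proper_edge_coloring_chromatic_index:
  assumes "finite (edges G)"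
  shows "\<exists>c. proper_edge_coloring G (chromatic_index G) c"
proof -
  obtain h where h: "bij_betw h (edges G) {1..card (edges G)}"
    using finite_same_card_bij[OF assms, of "{1..card (edges G)}"] by auto
  then have "proper_edge_coloring G (card (edges G)) h"
    unfolding proper_edge_coloring_iff proper_def bij_betw_def inj_on_def by auto
  then show ?thesis
    unfolding chromatic_index_def by (intro LeastI[of "\<lambda>k. \<exists>c. proper_edge_coloring G k c"]) blast
qed

section \<open>Cutting off a vertex by its star\<close>

lemma star_isolates:
  assumes "(u, w) \<in> rtrancl_on V {(a, b) \<in> A. {a, b} \<notin> {e \<in> E. v \<in> e}}"
    and "\<And>a b. (a, b) \<in> A \<Longrightarrow> {a, b} \<in> E" and "u \<noteq> w"
  shows "u \<noteq> v \<and> w \<noteq> v"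
  using assms(1,3)
proof (induction rule: rtrancl_on_induct)
  \<comment> \<open>No remaining arc touches \<open>v\<close>, so only the trivial walk can start or
    end there.\<close>
  case (step a b)
  then show ?case using assms(2) by auto
qed simp

lemma star_rainbow_cut:
  assumes G: "pair_graph G" and uv: "u \<in> pverts G" "v \<in> pverts G" "u \<noteq> v"
    and w: "w \<in> {u, v}" and inj: "inj_on c {e \<in> edges G. w \<in> e}"
  shows "uv_rainbow_cut G c u v {e \<in> edges G. w \<in> e}"
proof -
  let ?H = "delete_edges G {e \<in> edges G. w \<in> e}"
  let ?A = "{(a, b) \<in> parcs G. {a, b} \<notin> {e \<in> edges G. w \<in> e}}"
  have verts: "pverts ?H = pverts G" and arcs: "parcs ?H = ?A"
    unfolding delete_edges_def by auto
  \<comment> \<open>\<open>connected\<close> refers to the symmetric closure, but deleting edges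
    keeps the arc relation symmetric. The same unreachability thus shows both that the graph is
    disconnected and that the two components differ.\<close>
  have sym: "parcs (mk_symmetric (with_proj ?H)) = ?A"
    using parcs_eq_edges[OF G] unfolding parcs_mk_symmetric
    by (auto simp: arcs insert_commute)
  have not_reach: "(u, v) \<notin> rtrancl_on V ?A" for V
    using star_isolates[of u v V "parcs G" "edges G" w] parcs_eq_edges[OF G] uv(3) w by blast
  have "\<not> connected (with_proj ?H)"
    using not_reach[of "pverts G"] uv
    unfolding connected_def strongly_connected_def reachable_def
    by (auto simp: sym verts)
  moreover have "pre_digraph.scc_of (with_proj ?H) u \<noteq> pre_digraph.scc_of (with_proj ?H) v"
  proof
    assume "pre_digraph.scc_of (with_proj ?H) u = pre_digraph.scc_of (with_proj ?H) v"
    moreover have "v \<in> pre_digraph.scc_of (with_proj ?H) v"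
      using uv unfolding pre_digraph.scc_of_def reachable_def by (auto simp: verts)
    ultimately have "v \<in> pre_digraph.scc_of (with_proj ?H) u" by simp
    then show False
      using not_reach[of "pverts G"] unfolding pre_digraph.scc_of_def reachable_def
      by (simp add: verts arcs)
  qed
  ultimately show ?thesis
    using inj unfolding uv_rainbow_cut_def rainbow_cut_def edge_cut_def by blast
qed

text \<open>One exceptional vertex \<open>y\<close> does no harm: of two distinct vertices at least
  one differs from \<open>y\<close>, and its star is the cut.\<close>

lemma rd_le:
  assumes "pair_graph G" and "c ` edges G \<subseteq> {1..k}"
    and "\<And>w. w \<noteq> y \<Longrightarrow> inj_on c {e \<in> edges G. w \<in> e}"
  shows "rd G \<le> k"
proof -
  have "rainbow_disconnected G c"
    unfolding rainbow_disconnected_def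
  proof (intro ballI impI)
    fix u v assume uv: "u \<in> pverts G" "v \<in> pverts G" "u \<noteq> v"
    then obtain w where "w \<in> {u, v}" "w \<noteq> y" by auto
    then show "\<exists>R. uv_rainbow_cut G c u v R"
      using star_rainbow_cut[OF assms(1) uv] assms(3) by blast
  qed
  then show ?thesis
    using assms(2) unfolding rd_def edge_coloring_def by (intro Least_le) blast
qed

lemma proper_inj_on_star: "proper E c \<Longrightarrow> inj_on c {e \<in> E. v \<in> e}"
  unfolding inj_on_def using properD[of E c _ _ v] by blast

section \<open>Bounding \<open>rd\<close> by the maximum degree\<close>

theorem theorem3:
  fixes G :: "'a pair_pre_digraph"
  assumes "pair_graph G"
    and "connected (with_proj G)"
    and "minimal_chromatic_index G"
  shows "rd G \<le> max_degree G"
proof -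
  let ?E = "edges G" and ?k = "chromatic_index G" and ?D = "max_degree G"
  have fin: "finite ?E"
    using finite_edges[OF assms(1)] .
  show ?thesis
  proof (cases "?k \<le> ?D")
    case True
    obtain c where c: "c ` ?E \<subseteq> {1..?k}" "proper ?E c"
      using proper_edge_coloring_chromatic_index[OF fin] proper_edge_coloring_iff by blast
    then have "rd G \<le> ?k"
      using rd_le[OF assms(1) c(1)] proper_inj_on_star[OF c(2)] by simp
    then show ?thesis
      using True by simp
  next
    case False
    have "?E \<noteq> {}"
      using assms(3) unfolding minimal_chromatic_index_def by auto
    then obtain e where e: "e \<in> ?E" by blast
    then have k: "Suc (chromatic_index (delete_edges G {e})) = ?k"
      using assms(3) unfolding minimal_chromatic_index_def by fastforce
    let ?m = "chromatic_index (delete_edges G {e})"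
    obtain c where c: "c ` (?E - {e}) \<subseteq> {1..?m}" "proper (?E - {e}) c"
      using proper_edge_coloring_chromatic_index[of "delete_edges G {e}"] fin
        proper_edge_coloring_iff[of "delete_edges G {e}"] edges_delete_edge[of G e] by auto
    \<comment> \<open>If \<open>?m\<close> exceeded every degree, the colouring of
      \<open>G - e\<close> would extend to \<open>G\<close> with the same \<open>?m\<close> colours,
      although \<open>?k\<close> is \<open>Suc ?m\<close>.\<close>
    have "?m \<le> ?D"
    proof (rule ccontr)
      assume "\<not> ?m \<le> ?D"
      then have "card {e \<in> ?E. v \<in> e} < card {1..?m}" for v
        using card_star_le_max_degree[OF assms(1), of v] by simp
      then obtain c' where "proper ?E c'" "c' ` ?E \<subseteq> {1..?m}"
        using vizing_extension[OF fin, of "{1..?m}" e c] card_edge[OF assms(1)] e c by auto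
      then have "?k \<le> ?m"
        unfolding chromatic_index_def[of G] proper_edge_coloring_iff by (intro Least_le) blast
      then show False
        using k by simp
    qed
    then have m: "?m = ?D"
      using False k by simp
    obtain x y where xy: "e = {x, y}" "x \<noteq> y"
      using card_edge[OF assms(1) e] by (auto simp: card_2_iff)
    have "card {f \<in> ?E - {e}. x \<in> f} < card {f \<in> ?E. x \<in> f}"
      using fin e xy by (intro psubset_card_mono) auto
    then have "card {f \<in> ?E - {e}. x \<in> f} < card {1..?D}"
      using card_star_le_max_degree[OF assms(1), of x] by simp
    then obtain \<alpha> where \<alpha>: "\<alpha> \<in> {1..?D}" "misses (?E - {e}) c x \<alpha>"
      using exists_missing[of "?E - {e}" "{1..?D}" x c] fin by blast
    let ?c = "c(e := \<alpha>)"
    have "inj_on ?c {f \<in> ?E. w \<in> f}" if "w \<noteq> y" for w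
    proof (rule inj_onI)
      fix f g assume fg: "f \<in> {f \<in> ?E. w \<in> f}" "g \<in> {f \<in> ?E. w \<in> f}" "?c f = ?c g"
      \<comment> \<open>The new colour matters only if \<open>w\<close> is an end of
        \<open>e\<close>; then \<open>w\<close> is \<open>x\<close>, where \<alpha> was
        missing.\<close>
      have "c h \<noteq> \<alpha>" if "h \<in> ?E" "h \<noteq> e" "w \<in> h" "w \<in> e" for h
        using \<alpha>(2) that xy \<open>w \<noteq> y\<close> unfolding misses_def by auto
      then show "f = g"
        using fg properD[OF c(2), of f g w] by (auto split: if_splits)
    qed
    moreover have "?c ` ?E \<subseteq> {1..?D}"
      using c(1) \<alpha>(1) m by auto
    ultimately show ?thesis
      by (intro rd_le[OF assms(1), of ?c _ y])
  qed
qed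

end
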